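(* Let $(A,+,\cdot)$ be a left nilpotent pre-Lie ring of cardinality $p^n$, where $p$ is a prime with $p\ge n+2$. Let $\Omega:A\to A$ be the inverse of the bijection $W$, and define $a\circ b=a+e^{L_{\Omega(a)}}(b)$ (the group of flows). Then $(A,+,\circ)$ is a left brace, and it is left nilpotent.
   Context: A (left) brace is a set $A$ with binary operations $+,\circ$ such that $(A,+)$ is an abelian group, $(A,\circ)$ is a group, and $a\circ(b+c)+a=a\circ b+a\circ c$ for all $a,b,c$; with $a*b=a\circ b-a-b$, it is left nilpotent if $A^m=0$ for some $m$, where $A^1=A$ and $A^{i+1}$ is the additive subgroup generated by $a*b$ ($a\in A,b\in A^i$). A pre-Lie ring is an abelian group $(A,+)$ with a biadditive product $\cdot$ satisfying $(x\cdot y)\cdot z-x\cdot(y\cdot z)=(y\cdot x)\cdot z-y\cdot(x\cdot z)$; left nilpotency is defined as for braces with $\cdot$ in place of $*$. Let $A^{\mathrm{id}}=A\times\mathbb Z$ with $(r,m)+(s,m')=(r+s,m+m')$, $(r,m)\cdot(s,m')=(r\cdot s+ms+m'r,mm')$; identify $A$ with $A\times\{0\}$, put $1=(0,1)$. For $a\in A$ let $L_a(x)=a\cdot x$ and $e^{L_a}(x)=\sum_{j\ge 0}\frac{1}{j!}L_a^j(x)$ for $x\in A^{\mathrm{id}}$ (finite sum since $A^{n+1}=0$; the needed factorials are invertible modulo $p^n$). Let $W(a)=e^{L_a}(1)-1\in A$; $W:A\to A$ is a bijection. *)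

theory Defs
  imports Main "HOL-Computational_Algebra.Primes"
begin

definition nmul :: "nat \<Rightarrow> 'a::ab_group_add \<Rightarrow> 'a" where
  "nmul k x = (\<Sum>i<k. x)"

definition zmul :: "int \<Rightarrow> 'a::ab_group_add \<Rightarrow> 'a" where
  "zmul k x = (if k \<ge> 0 then nmul (nat k) x else - nmul (nat (- k)) x)"

text \<open>Division by a natural number k (meaningful when multiplication by k is bijective,
  e.g. k coprime to the order of the group).\<close>
definition divnat :: "nat \<Rightarrow> 'a::ab_group_add \<Rightarrow> 'a" where
  "divnat k x = (THE y. nmul k y = x)"

definition pre_lie :: "('a::ab_group_add \<Rightarrow> 'a \<Rightarrow> 'a) \<Rightarrow> bool" where
  "pre_lie m \<longleftrightarrow>
     (\<forall>x y z. m (x + y) z = m x z + m y z) \<and>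
     (\<forall>x y z. m x (y + z) = m x y + m x z) \<and>
     (\<forall>x y z. m (m x y) z - m x (m y z) = m (m y x) z - m y (m x z))"

inductive_set addgen :: "'a::ab_group_add set \<Rightarrow> 'a set" for S where
  zero: "0 \<in> addgen S"
| gen: "x \<in> S \<Longrightarrow> x \<in> addgen S"
| add: "x \<in> addgen S \<Longrightarrow> y \<in> addgen S \<Longrightarrow> x + y \<in> addgen S"
| neg: "x \<in> addgen S \<Longrightarrow> - x \<in> addgen S"

text \<open>lpow s i is A^i (A^1 = A; A^0 also set to A for totality).\<close>
fun lpow :: "('a::ab_group_add \<Rightarrow> 'a \<Rightarrow> 'a) \<Rightarrow> nat \<Rightarrow> 'a set" where
  "lpow s 0 = UNIV"
| "lpow s (Suc 0) = UNIV"
| "lpow s (Suc (Suc i)) = addgen {s a b | a b. b \<in> lpow s (Suc i)}"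

definition left_nilpotent :: "('a::ab_group_add \<Rightarrow> 'a \<Rightarrow> 'a) \<Rightarrow> bool" where
  "left_nilpotent s \<longleftrightarrow> (\<exists>k. lpow s k = {0})"

definition is_left_brace :: "('a::ab_group_add \<Rightarrow> 'a \<Rightarrow> 'a) \<Rightarrow> bool" where
  "is_left_brace c \<longleftrightarrow>
     (\<forall>a b d. c (c a b) d = c a (c b d)) \<and>
     (\<exists>e. (\<forall>a. c e a = a \<and> c a e = a) \<and> (\<forall>a. \<exists>b. c a b = e \<and> c b a = e)) \<and>
     (\<forall>a b d. c a (b + d) + a = c a b + c a d)"

definition brace_star :: "('a::ab_group_add \<Rightarrow> 'a \<Rightarrow> 'a) \<Rightarrow> 'a \<Rightarrow> 'a \<Rightarrow> 'a" where
  "brace_star c a b = c a b - a - b"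

definition id_add :: "'a::ab_group_add \<times> int \<Rightarrow> 'a \<times> int \<Rightarrow> 'a \<times> int" where
  "id_add x y = (fst x + fst y, snd x + snd y)"

definition id_mult :: "('a::ab_group_add \<Rightarrow> 'a \<Rightarrow> 'a) \<Rightarrow> 'a \<times> int \<Rightarrow> 'a \<times> int \<Rightarrow> 'a \<times> int" where
  "id_mult m x y = (m (fst x) (fst y) + zmul (snd x) (fst y) + zmul (snd y) (fst x),
                    snd x * snd y)"

definition Lop :: "('a::ab_group_add \<Rightarrow> 'a \<Rightarrow> 'a) \<Rightarrow> 'a \<Rightarrow> 'a \<times> int \<Rightarrow> 'a \<times> int" where
  "Lop m a x = id_mult m (a, 0) x"

text \<open>e^{L_a}(x) = sum_{j>=0} (1/j!) L_a^j(x), truncated at j = N (here N = n, using A^{n+1}=0).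
  For j >= 1, L_a^j(x) lies in A = A \<times> {0}, so 1/j! acts on the A-component.\<close>
definition expL :: "('a::ab_group_add \<Rightarrow> 'a \<Rightarrow> 'a) \<Rightarrow> nat \<Rightarrow> 'a \<Rightarrow> 'a \<times> int \<Rightarrow> 'a \<times> int" where
  "expL m N a x = id_add x (\<Sum>j\<in>{1..N}. divnat (fact j) (fst ((Lop m a ^^ j) x)), 0)"

definition Wmap :: "('a::ab_group_add \<Rightarrow> 'a \<Rightarrow> 'a) \<Rightarrow> nat \<Rightarrow> 'a \<Rightarrow> 'a" where
  "Wmap m N a = fst (id_add (expL m N a (0, 1)) (0, -1))"

definition Omega :: "('a::ab_group_add \<Rightarrow> 'a \<Rightarrow> 'a) \<Rightarrow> nat \<Rightarrow> 'a \<Rightarrow> 'a" where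
  "Omega m N = inv (Wmap m N)"

definition flow_circ :: "('a::ab_group_add \<Rightarrow> 'a \<Rightarrow> 'a) \<Rightarrow> nat \<Rightarrow> 'a \<Rightarrow> 'a \<Rightarrow> 'a" where
  "flow_circ m N a b = a + fst (expL m N (Omega m N a) (b, 0))"

end

theory Submission
  imports Defs "HOL-Computational_Algebra.Formal_Power_Series" "HOL-Number_Theory.Cong"
    "HOL-Library.Product_Plus"
begin

text \<open>
  The operators \<open>L\<^sub>a\<close> on \<open>A \<times> \<int>\<close> form a Lie ring by the pre-Lie identity, and they raise the filtration
  \<open>A \<times> \<int> \<supseteq> A \<supseteq> A\<^sup>2 \<supseteq> \<dots>\<close>, which vanishes after \<open>n + 1\<close> steps. Since \<open>n < p\<close>, the needed part of the
  Baker-Campbell-Hausdorff theorem holds: the exponentials \<open>e\<^bsup>L\<^sub>a\<^esup>\<close> are closed under composition.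
  To see this, grade by a variable \<open>t\<close> and compare the logarithmic derivatives of \<open>e\<^bsup>ta\<^esup> e\<^bsup>tb\<^esup>\<close> and
  \<open>e\<^bsup>c(t)\<^esup>\<close>; the equation for \<open>c\<close> is solved coefficient by coefficient inside the Lie ring.
  So the exponentials form a group acting on \<open>A \<times> {1}\<close>. The stabiliser of \<open>(0, 1)\<close> is trivial, because
  \<open>W(a) - a\<close> lies one step deeper in the filtration than \<open>a\<close>; hence the action is simply transitive
  and \<open>W\<close> is bijective. The operation \<open>\<circ>\<close> is the group law transported along the orbit map
  \<open>a \<mapsto> e\<^bsup>L\<^sub>a\<^esup>(0, 1)\<close>.
\<close>

unbundle fps_syntax

subsection \<open>Exponentials and commutators\<close>

text \<open>Minus the usual \<open>ad c\<close>. With this sign powers of \<open>c\<close> collect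
  on the left, and passing from \<open>x\<close> to e^{-c} x e^c is the exponential of
  \<open>rad c\<close>.\<close>

definition rad :: "'r::ring_1 \<Rightarrow> 'r \<Rightarrow> 'r" where
  "rad c x = x * c - c * x"

text \<open>Right multiplication by \<open>c\<close> is the sum of left multiplication by
  \<open>c\<close> and \<open>rad c\<close>, which commute; the binomial theorem applies to this
  sum.\<close>

lemma mult_power_rad:
  fixes x c :: "'r::ring_1"
  shows "x * c ^ k = (\<Sum>j\<le>k. of_nat (k choose j) * (c ^ (k - j) * (rad c ^^ j) x))"
proof (induction k)
  case 0
  show ?case by simp
next
  case (Suc k)
  let ?y = "\<lambda>j. (rad c ^^ j) x"
  have y: "?y j * c = c * ?y j + ?y (Suc j)" for j
    by (simp add: rad_def)
  have "x * c ^ Suc k = (\<Sum>j\<le>k. of_nat (k choose j) * (c ^ (k - j) * (?y j * c)))"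
    by (simp add: power_Suc2 Suc.IH sum_distrib_right mult.assoc flip: mult.assoc[of x] del: power_Suc)
  also have "\<dots> = (\<Sum>j\<le>k. of_nat (k choose j) * (c ^ (Suc k - j) * ?y j))
      + (\<Sum>j\<le>k. of_nat (k choose j) * (c ^ (k - j) * ?y (Suc j)))"
    unfolding y
    by (simp add: distrib_left sum.distrib Suc_diff_le power_Suc2 mult.assoc del: power_Suc funpow.simps)
  also have "(\<Sum>j\<le>k. of_nat (k choose j) * (c ^ (Suc k - j) * ?y j))
      = (\<Sum>j\<le>Suc k. of_nat (k choose j) * (c ^ (Suc k - j) * ?y j))"
    by (simp add: binomial_eq_0)
  also have "\<dots> + (\<Sum>j\<le>k. of_nat (k choose j) * (c ^ (k - j) * ?y (Suc j)))
      = (\<Sum>j\<le>Suc k. of_nat (Suc k choose j) * (c ^ (Suc k - j) * ?y j))"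
    unfolding sum.atMost_Suc_shift by (simp add: sum.distrib algebra_simps del: power_Suc funpow.simps)
  finally show ?case .
qed

text \<open>Leibniz splits off one factor, \<open>mult_power_rad\<close> moves the other powers to
  the left, and Pascal's rule adds the coefficients.\<close>

lemma derivation_power:
  fixes c :: "'r::ring_1"
  assumes leibniz: "\<And>x y. D (x * y) = D x * y + x * D y"
  shows "D (c ^ Suc k) = (\<Sum>j\<le>k. of_nat (Suc k choose Suc j) * (c ^ (k - j) * (rad c ^^ j) (D c)))"
proof (induction k)
  case 0
  show ?case by simp
next
  case (Suc k)
  let ?y = "\<lambda>j. (rad c ^^ j) (D c)"
  have "D (c ^ Suc (Suc k)) = D c * c ^ Suc k + c * D (c ^ Suc k)"
    by (metis leibniz power_Suc)
  also have "c * D (c ^ Suc k) = (\<Sum>j\<le>k. of_nat (Suc k choose Suc j) * (c ^ (Suc k - j) * ?y j))"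
    unfolding Suc.IH sum_distrib_left
    by (intro sum.cong refl) (simp add: Suc_diff_le mult_of_nat_commute mult.assoc flip: mult.assoc[of c "of_nat _"] del: binomial_Suc_Suc)
  also have "\<dots> = (\<Sum>j\<le>Suc k. of_nat (Suc k choose Suc j) * (c ^ (Suc k - j) * ?y j))"
    by (simp add: binomial_eq_0)
  finally show ?case
    unfolding mult_power_rad[of "D c"]
    by (simp only: binomial_Suc_Suc[of "Suc k"] of_nat_add distrib_right sum.distrib)
qed

lemma sum_triangle_eq_square:
  fixes h :: "nat \<Rightarrow> nat \<Rightarrow> 'b::comm_monoid_add"
  assumes "\<And>i j. i + j > N \<Longrightarrow> h i j = 0"
  shows "(\<Sum>k\<le>N. \<Sum>j\<le>k. h (k - j) j) = (\<Sum>i\<le>N. \<Sum>j\<le>N. h i j)"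
proof -
  have "(\<Sum>k\<le>N. \<Sum>j\<le>k. h (k - j) j) = (\<Sum>(j,i)\<in>{(j,i). j + i \<le> N}. h i j)"
    using sum.triangle_reindex_eq[of "\<lambda>j i. h i j" N] by simp
  also have "\<dots> = (\<Sum>(j,i)\<in>{..N} \<times> {..N}. h i j)"
    by (intro sum.mono_neutral_left) (auto intro!: assms)
  also have "\<dots> = (\<Sum>j\<le>N. \<Sum>i\<le>N. h i j)"
    by (simp add: sum.cartesian_product)
  finally show ?thesis
    by (simp add: sum.swap[of "\<lambda>i j. h i j"])
qed

text \<open>The integers \<open>J k\<close> stand for \<open>1/k!\<close>; they act as such on everything killed by \<open>q\<close>. As the constant
  term of an exponential need not be killed by \<open>q\<close>, \<open>J 0\<close> has to be exactly 1.\<close>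

definition inverse_factorials :: "nat \<Rightarrow> nat \<Rightarrow> (nat \<Rightarrow> nat) \<Rightarrow> bool" where
  "inverse_factorials q N J \<longleftrightarrow> J 0 = 1 \<and> (\<forall>k\<le>N. [fact k * J k = 1] (mod q))"

definition trunc_exp :: "(nat \<Rightarrow> nat) \<Rightarrow> nat \<Rightarrow> 'r::ring_1 \<Rightarrow> 'r" where
  "trunc_exp J N c = (\<Sum>k\<le>N. of_nat (J k) * c ^ k)"

lemma of_nat_mult_cong:
  fixes x :: "'r::ring_1"
  assumes "[a = b] (mod q)" "of_nat q * x = 0"
  shows "of_nat a * x = of_nat b * x"
proof -
  have "of_nat a * x = of_nat (a mod q) * x" for a
  proof -
    have "(of_nat a :: 'r) = of_nat (a div q) * of_nat q + of_nat (a mod q)"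
      by (simp flip: of_nat_mult of_nat_add)
    then show ?thesis
      by (simp add: distrib_right mult.assoc assms(2))
  qed
  then show ?thesis
    using assms(1) by (metis cong_def)
qed

lemma cong_cancel_fact:
  assumes "inverse_factorials q N J" "k \<le> N" "[fact k * a = fact k * b] (mod q)"
  shows "[a = (b::nat)] (mod q)"
proof -
  have "coprime (fact k) q"
    using assms(1,2) unfolding inverse_factorials_def by (metis cong_imp_coprime cong_sym coprime_1_left coprime_mult_left_iff)
  then show ?thesis
    using assms(3) cong_mult_lcancel_nat by blast
qed

text \<open>Multiplied by k!, both sides become congruent to the binomial coefficient, and k! is a
  unit modulo \<open>q\<close>.\<close>

lemma inverse_factorials_binomial:
  assumes J: "inverse_factorials q N J" and "j \<le> k" "k \<le> N"
  shows "[J k * (k choose j) = J (k - j) * J j] (mod q)"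
proof (rule cong_cancel_fact[OF J \<open>k \<le> N\<close>])
  have J1: "[fact i * J i = 1] (mod q)" if "i \<le> N" for i
    using J that by (auto simp: inverse_factorials_def)
  have "[fact k * J k * (k choose j) = 1 * (k choose j)] (mod q)"
    by (intro cong_mult J1 assms cong_refl)
  moreover have "[(k choose j) * ((fact (k - j) * J (k - j)) * (fact j * J j)) = (k choose j) * (1 * 1)] (mod q)"
    using assms by (intro cong_mult J1 cong_refl) auto
  moreover have "(k choose j) * ((fact (k - j) * J (k - j)) * (fact j * J j)) = fact k * (J (k - j) * J j)"
    by (simp add: binomial_fact_lemma[OF \<open>j \<le> k\<close>, symmetric])
  ultimately show "[fact k * (J k * (k choose j)) = fact k * (J (k - j) * J j)] (mod q)"
    by (metis cong_sym cong_trans mult.assoc mult_1 mult_1_right)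
qed

lemma inverse_factorials_1:
  assumes "inverse_factorials q N J" "1 \<le> N"
  shows "[J 1 = 1] (mod q)"
  using assms unfolding inverse_factorials_def by fastforce

lemma of_nat_mult_rad_eq_0:
  fixes x :: "'r::ring_1"
  assumes "of_nat q * x = 0"
  shows "of_nat q * (c * (rad d ^^ j) x) = 0"
proof -
  have *: "of_nat q * (c * y) = 0" if "of_nat q * y = 0" for c y :: 'r
    using that by (metis mult.assoc mult_of_nat_commute mult_zero_right)
  have "of_nat q * (rad d ^^ j) x = 0"
  proof (induction j)
    case (Suc j)
    then show ?case
      by (simp add: rad_def right_diff_distrib *) (simp flip: mult.assoc)
  qed (simp add: assms)
  then show ?thesis
    by (rule *)
qed

text \<open>The conjugation formula e^{-c} x e^c = e^{rad c} x, multiplied by e^c. The hypothesis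
  \<open>nil\<close> makes the truncated Cauchy product exact.\<close>

lemma mult_trunc_exp:
  fixes x c :: "'r::ring_1"
  assumes J: "inverse_factorials q N J" and x: "of_nat q * x = 0"
    and nil: "\<And>i j. i + j > N \<Longrightarrow> c ^ i * (rad c ^^ j) x = 0"
  shows "x * trunc_exp J N c = trunc_exp J N c * (\<Sum>j\<le>N. of_nat (J j) * (rad c ^^ j) x)"
proof -
  let ?h = "\<lambda>i j. of_nat (J i * J j) * (c ^ i * (rad c ^^ j) x)"
  have "x * trunc_exp J N c = (\<Sum>k\<le>N. of_nat (J k) * (x * c ^ k))"
    unfolding trunc_exp_def sum_distrib_left
    by (intro sum.cong refl) (metis mult.assoc mult_of_nat_commute)
  also have "\<dots> = (\<Sum>k\<le>N. \<Sum>j\<le>k. of_nat (J k * (k choose j)) * (c ^ (k - j) * (rad c ^^ j) x))"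
    unfolding mult_power_rad sum_distrib_left by (simp add: mult.assoc)
  also have "\<dots> = (\<Sum>k\<le>N. \<Sum>j\<le>k. ?h (k - j) j)"
    by (intro sum.cong refl of_nat_mult_cong[where q = q] of_nat_mult_rad_eq_0
        inverse_factorials_binomial[OF J] x) auto
  also have "\<dots> = (\<Sum>i\<le>N. \<Sum>j\<le>N. ?h i j)"
    by (intro sum_triangle_eq_square) (simp add: nil)
  also have "\<dots> = trunc_exp J N c * (\<Sum>j\<le>N. of_nat (J j) * (rad c ^^ j) x)"
    unfolding trunc_exp_def sum_product of_nat_mult
    by (intro sum.cong refl) (metis mult.assoc mult_of_nat_commute)
  finally show ?thesis .
qed

text \<open>The logarithmic derivative of e^c is (e^{rad c} - 1) / rad c applied to
  \<open>D c\<close>. Differentiation uses up one factor \<open>c\<close>, so terms must vanish from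
  total degree \<open>N\<close> on. This also kills the term with \<open>J (Suc N)\<close>, a value
  left open by \<open>inverse_factorials\<close>.\<close>

lemma derivation_trunc_exp:
  fixes c :: "'r::ring_1"
  assumes J: "inverse_factorials q N J" and x: "of_nat q * D c = 0"
    and leibniz: "\<And>x y. D (x * y) = D x * y + x * D y"
    and add: "\<And>x y. D (x + y) = D x + D y"
    and nil: "\<And>i j. i + j \<ge> N \<Longrightarrow> c ^ i * (rad c ^^ j) (D c) = 0"
  shows "D (trunc_exp J N c) = trunc_exp J N c * (\<Sum>j\<le>N. of_nat (J (Suc j)) * (rad c ^^ j) (D c))"
proof -
  let ?h = "\<lambda>i j. of_nat (J i * J (Suc j)) * (c ^ i * (rad c ^^ j) (D c))"
  have D0: "D 0 = 0"
    using add[of 0 0] by simp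
  have D1: "D 1 = 0"
    using leibniz[of 1 1] by simp
  have Dnat: "D (of_nat k * y) = of_nat k * D y" for k y
    by (induction k) (simp_all add: D0 add distrib_right)
  have Dsum: "D (sum f {..k::nat}) = (\<Sum>i\<le>k. D (f i))" for f k
    by (induction k) (simp_all add: add)
  have sq: "(\<Sum>i\<le>N. \<Sum>j\<le>N. ?h i j) = trunc_exp J N c * (\<Sum>j\<le>N. of_nat (J (Suc j)) * (rad c ^^ j) (D c))"
    unfolding trunc_exp_def sum_product of_nat_mult
    by (intro sum.cong refl) (metis mult.assoc mult_of_nat_commute)
  have "D (trunc_exp J N c) = (\<Sum>k\<le>N. of_nat (J k) * D (c ^ k))"
    by (simp add: trunc_exp_def Dnat Dsum)
  also have "\<dots> = (\<Sum>k\<le>N. \<Sum>j\<le>k. ?h (k - j) j)"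
  proof (cases N)
    case 0
    then show ?thesis by (simp add: D1 nil[of 0 0, simplified])
  next
    case (Suc M)
    have "(\<Sum>k\<le>N. of_nat (J k) * D (c ^ k)) = (\<Sum>k\<le>M. of_nat (J (Suc k)) * D (c ^ Suc k))"
      by (simp only: Suc sum.atMost_Suc_shift power_0 D1 mult_zero_right add_0_left)
    also have "\<dots> = (\<Sum>k\<le>M. \<Sum>j\<le>k. of_nat (J (Suc k) * (Suc k choose Suc j)) * (c ^ (k - j) * (rad c ^^ j) (D c)))"
      unfolding derivation_power[of D, OF leibniz] sum_distrib_left by (simp only: mult.assoc of_nat_mult)
    also have "\<dots> = (\<Sum>k\<le>M. \<Sum>j\<le>k. ?h (k - j) j)"
    proof (intro sum.cong refl of_nat_mult_cong[where q = q] of_nat_mult_rad_eq_0 x)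
      fix k j
      assume "k \<in> {..M}" "j \<in> {..k}"
      then show "[J (Suc k) * (Suc k choose Suc j) = J (k - j) * J (Suc j)] (mod q)"
        using inverse_factorials_binomial[OF J, of "Suc j" "Suc k"] Suc by simp
    qed
    \<comment> \<open>The diagonal of total degree \<open>N\<close> does not come from the
      derivative; it may be added because it vanishes.\<close>
    also have "\<dots> = (\<Sum>k\<le>N. \<Sum>j\<le>k. ?h (k - j) j)"
    proof -
      have "(\<Sum>j\<le>N. ?h (N - j) j) = 0"
        by (intro sum.neutral ballI) (simp add: nil)
      then show ?thesis
        unfolding Suc sum.atMost_Suc[of _ M] by (simp del: of_nat_mult)
    qed
    finally show ?thesis .
  qed
  also have "\<dots> = (\<Sum>i\<le>N. \<Sum>j\<le>N. ?h i j)"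
    by (intro sum_triangle_eq_square) (simp add: nil)
  finally show ?thesis
    unfolding sq .
qed

subsection \<open>Closure of exponentials under multiplication\<close>

text \<open>The operator t d/dt instead of d/dt: it keeps degrees, hence preserves the sets
  \<open>U i\<close> below, and obeys Leibniz over noncommutative coefficients too.\<close>

definition euler :: "'r::ring_1 fps \<Rightarrow> 'r fps" where
  "euler f = Abs_fps (\<lambda>k. of_nat k * f $ k)"

lemma euler_nth [simp]: "euler f $ k = of_nat k * f $ k"
  by (simp add: euler_def)

lemma euler_add: "euler (f + h) = euler f + euler h"
  by (simp add: fps_eq_iff distrib_left)

lemma euler_diff: "euler (f - h) = euler f - euler h"
  by (simp add: fps_eq_iff right_diff_distrib)

lemma euler_mult: "euler (f * h) = euler f * h + f * euler h"
proof (rule fps_ext)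
  fix k
  have "of_nat k * (f $ i * h $ (k - i)) = of_nat i * f $ i * h $ (k - i) + f $ i * (of_nat (k - i) * h $ (k - i))"
    if "i \<le> k" for i
  proof -
    have "(of_nat k :: 'a) = of_nat i + of_nat (k - i)"
      using that by (simp flip: of_nat_add)
    then show ?thesis
      by (metis distrib_right mult.assoc mult_of_nat_commute)
  qed
  then show "euler (f * h) $ k = (euler f * h + f * euler h) $ k"
    by (simp add: fps_mult_nth sum_distrib_left flip: sum.distrib)
qed

definition linear_fps :: "'r::ring_1 \<Rightarrow> 'r fps" where
  "linear_fps x = Abs_fps (\<lambda>k. if k = 1 then x else 0)"

lemma linear_fps_nth [simp]: "linear_fps x $ k = (if k = 1 then x else 0)"
  by (simp add: linear_fps_def)

lemma euler_linear_fps [simp]: "euler (linear_fps x) = linear_fps x"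
  by (simp add: fps_eq_iff)

lemma linear_fps_uminus: "linear_fps (- x) = - linear_fps x"
  by (simp add: fps_eq_iff)

lemma rad_funpow_self: "(rad c ^^ j) c = (if j = 0 then c else 0)"
proof -
  have "(rad c ^^ Suc j) c = 0" for j
    by (induction j) (simp_all add: rad_def)
  then show ?thesis
    by (cases j) auto
qed

text \<open>The factor \<open>(e\<^bsup>ad\<^esup> - 1) / ad\<close> applied to the derivative of \<open>c\<close>, with \<open>ad = rad c\<close>, which is
  \<open>e\<^bsup>-c\<^esup>\<close> times the derivative of \<open>e\<^bsup>c\<^esup>\<close>.\<close>

definition expfactor :: "(nat \<Rightarrow> nat) \<Rightarrow> nat \<Rightarrow> 'r::ring_1 fps \<Rightarrow> 'r fps" where
  "expfactor J N c = (\<Sum>j\<le>N. of_nat (J (Suc j)) * (rad c ^^ j) (euler c))"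

text \<open>Abstracts operators on A x Z that raise its filtration by \<open>k\<close>. Torsion is
  asked only from \<open>P 1\<close> on, since the identity operator, in \<open>P 0\<close>, is not
  torsion.\<close>

locale filtered_ring =
  fixes P :: "nat \<Rightarrow> 'r::ring_1 set" and N q :: nat and J :: "nat \<Rightarrow> nat"
  assumes P_zero: "0 \<in> P k"
    and P_diff: "x \<in> P k \<Longrightarrow> y \<in> P k \<Longrightarrow> x - y \<in> P k"
    and P_one: "1 \<in> P 0"
    and P_mult: "x \<in> P i \<Longrightarrow> y \<in> P j \<Longrightarrow> x * y \<in> P (i + j)"
    and P_Suc: "P (Suc k) \<subseteq> P k"
    and P_vanish: "x \<in> P (Suc N) \<Longrightarrow> x = 0"
    and P_torsion: "x \<in> P 1 \<Longrightarrow> of_nat q * x = 0"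
    and J: "inverse_factorials q N J"
begin

abbreviation ex :: "'b::ring_1 \<Rightarrow> 'b" where
  "ex \<equiv> trunc_exp J N"

lemma P_mono: "i \<le> j \<Longrightarrow> x \<in> P j \<Longrightarrow> x \<in> P i"
  using lift_Suc_antimono_le[of P i j] P_Suc by blast

lemma P_uminus: "x \<in> P k \<Longrightarrow> - x \<in> P k"
  using P_diff[OF P_zero] by fastforce

lemma P_add: "x \<in> P k \<Longrightarrow> y \<in> P k \<Longrightarrow> x + y \<in> P k"
  using P_diff[of x k "- y"] P_uminus by auto

lemma P_sum: "(\<And>i. i \<in> A \<Longrightarrow> f i \<in> P k) \<Longrightarrow> sum f A \<in> P k"
  by (induction A rule: infinite_finite_induct) (auto intro: P_add P_zero)

lemma P_of_nat: "x \<in> P k \<Longrightarrow> of_nat m * x \<in> P k"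
  by (induction m) (auto simp: distrib_right intro: P_add P_zero)

lemma P_power: "x \<in> P 1 \<Longrightarrow> x ^ k \<in> P k"
  by (induction k) (use P_mult[of x 1] in \<open>auto intro: P_one\<close>)

lemma P_big: "k > N \<Longrightarrow> x \<in> P k \<Longrightarrow> x = 0"
  using P_mono[of "Suc N" k] P_vanish by simp

lemma P_J1:
  assumes "x \<in> P 1"
  shows "of_nat (J 1) * x = x"
proof (cases "1 \<le> N")
  case True
  show ?thesis
    using of_nat_mult_cong[OF inverse_factorials_1[OF J True] P_torsion[OF assms]] by simp
next
  \<comment> \<open>For \<open>N = 0\<close> the value \<open>J 1\<close> is uncontrolled, but
    \<open>P 1\<close> is then trivial.\<close>
  case False
  then have "x = 0"
    using P_big[of 1] assms by simp
  then show ?thesis by simp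
qed

text \<open>As (k+1)! = (k+1) k!, the integer \<open>J (Suc k) * fact k\<close> acts as
  1/(k+1).\<close>

lemma P_divide:
  assumes "x \<in> P 1" "Suc k \<le> N"
  shows "of_nat (Suc k) * (of_nat (J (Suc k) * fact k) * x) = x"
proof -
  have "of_nat (fact (Suc k) * J (Suc k)) * x = of_nat 1 * x"
    using assms J by (intro of_nat_mult_cong[where q = q] P_torsion) (auto simp: inverse_factorials_def simp del: fact_Suc)
  moreover have "fact (Suc k) * J (Suc k) = Suc k * (J (Suc k) * fact k)"
    by (simp add: algebra_simps)
  ultimately show ?thesis
    by (metis mult.assoc mult_1 of_nat_1 of_nat_mult)
qed

lemma P_cancel:
  assumes "x \<in> P 1" "Suc k \<le> N" "of_nat (Suc k) * x = 0"
  shows "x = 0"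
  using P_divide[OF assms(1,2)] assms(3) by (metis mult.assoc mult_of_nat_commute mult_zero_right)

text \<open>Coupling the degree in \<open>t\<close> with the filtration makes \<open>U i\<close> vanish for \<open>i > N\<close>, so that all
  truncations at \<open>N\<close> are exact and setting \<open>t = 1\<close> is multiplicative on \<open>U 0\<close>.\<close>

definition U :: "nat \<Rightarrow> 'r fps set" where
  "U i = {f. \<forall>k. f $ k \<in> P k \<and> (k < i \<longrightarrow> f $ k = 0)}"

lemma U_P: "f \<in> U i \<Longrightarrow> f $ k \<in> P k"
  and U_lt: "f \<in> U i \<Longrightarrow> k < i \<Longrightarrow> f $ k = 0"
  by (auto simp: U_def)

lemma U_zero: "0 \<in> U i"
  by (auto simp: U_def P_zero)

lemma U_one: "1 \<in> U 0"
  by (auto simp: U_def P_zero P_one)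

lemma U_add: "f \<in> U i \<Longrightarrow> h \<in> U i \<Longrightarrow> f + h \<in> U i"
  by (auto simp: U_def P_add)

lemma U_diff: "f \<in> U i \<Longrightarrow> h \<in> U i \<Longrightarrow> f - h \<in> U i"
  by (auto simp: U_def P_diff)

lemma U_of_nat: "f \<in> U i \<Longrightarrow> of_nat m * f \<in> U i"
  by (auto simp: U_def P_of_nat)

lemma U_sum: "(\<And>j. j \<in> A \<Longrightarrow> f j \<in> U i) \<Longrightarrow> sum f A \<in> U i"
  by (induction A rule: infinite_finite_induct) (auto intro: U_add U_zero)

lemma U_mult:
  assumes "f \<in> U i" "h \<in> U j"
  shows "f * h \<in> U (i + j)"
proof -
  have "f $ l * h $ (k - l) \<in> P k" if "l \<le> k" for k l
    using P_mult[OF U_P[OF assms(1), of l] U_P[OF assms(2), of "k - l"]] that by simp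
  moreover have "f $ l * h $ (k - l) = 0" if "k < i + j" "l \<le> k" for k l
  proof (cases "l < i")
    case False
    then have "k - l < j" using that by linarith
    then show ?thesis by (simp add: U_lt[OF assms(2)])
  qed (simp add: U_lt[OF assms(1)])
  ultimately show ?thesis
    by (auto simp: U_def fps_mult_nth intro!: P_sum)
qed

lemma U_mono: "i \<le> j \<Longrightarrow> f \<in> U j \<Longrightarrow> f \<in> U i"
  by (auto simp: U_def)

lemma U_big:
  assumes "f \<in> U i" "i > N"
  shows "f = 0"
proof (rule fps_ext)
  fix k
  show "f $ k = 0 $ k"
    using U_P[OF assms(1), of k] U_lt[OF assms(1), of k] P_big[of k "f $ k"] assms(2)
    by (cases "k < i") auto
qed

lemma U_torsion:
  assumes "f \<in> U 1"
  shows "of_nat q * f = 0"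
proof (rule fps_ext)
  fix k
  show "(of_nat q * f) $ k = 0 $ k"
    using U_P[OF assms, of k] U_lt[OF assms, of k] P_mono[of 1 k] P_torsion
    by (cases "k = 0") auto
qed

lemma U_J1:
  assumes "f \<in> U 1"
  shows "of_nat (J 1) * f = f"
proof (rule fps_ext)
  fix k
  show "(of_nat (J 1) * f) $ k = f $ k"
    using U_P[OF assms, of k] U_lt[OF assms, of k] P_mono[of 1 k] P_J1
    by (cases "k = 0") auto
qed

lemma U_euler: "f \<in> U i \<Longrightarrow> euler f \<in> U i"
  by (auto simp: U_def P_of_nat)

lemma U_power: "c \<in> U 1 \<Longrightarrow> c ^ i \<in> U i"
  by (induction i) (use U_mult[of c 1] in \<open>auto intro: U_one\<close>)

lemma U_power0: "c \<in> U 0 \<Longrightarrow> c ^ i \<in> U 0"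
  by (induction i) (use U_mult[of c 0 _ 0] in \<open>auto intro: U_one\<close>)

lemma U_rad: "c \<in> U i \<Longrightarrow> x \<in> U j \<Longrightarrow> rad c x \<in> U (i + j)"
  unfolding rad_def by (intro U_diff) (use U_mult[of x j c i] U_mult[of c i x j] in \<open>auto simp: add.commute\<close>)

lemma U_rad_funpow: "c \<in> U 1 \<Longrightarrow> x \<in> U 1 \<Longrightarrow> (rad c ^^ j) x \<in> U (Suc j)"
  by (induction j) (use U_rad[of c 1] in auto)

lemma U_trunc_exp: "c \<in> U 0 \<Longrightarrow> ex c \<in> U 0"
  unfolding trunc_exp_def by (intro U_sum U_of_nat U_power0) auto

lemma U_linear_fps: "x \<in> P 1 \<Longrightarrow> linear_fps x \<in> U 1"
  by (auto simp: U_def P_zero)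

lemma power_mult_rad_eq_0:
  assumes "c \<in> U 1" "x \<in> U 1" "i + j \<ge> N"
  shows "c ^ i * (rad c ^^ j) x = 0"
  using U_mult[OF U_power[OF assms(1), of i] U_rad_funpow[OF assms(1,2), of j]] assms(3)
  by (auto intro: U_big)

lemma mult_fps_exp:
  assumes "c \<in> U 1" "x \<in> U 1"
  shows "x * ex c = ex c * (\<Sum>j\<le>N. of_nat (J j) * (rad c ^^ j) x)"
  using assms by (intro mult_trunc_exp[OF J] U_torsion power_mult_rad_eq_0) auto

lemma euler_fps_exp:
  assumes "c \<in> U 1"
  shows "euler (ex c) = ex c * expfactor J N c"
  unfolding expfactor_def using assms
  by (intro derivation_trunc_exp[OF J] U_torsion power_mult_rad_eq_0 U_euler euler_add euler_mult) auto

text \<open>The series t x is its own Euler derivative, so the iterated commutators vanish and only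
  the term \<open>j = 0\<close> is left.\<close>

lemma euler_fps_exp_linear:
  assumes "x \<in> P 1"
  shows "euler (ex (linear_fps x)) = ex (linear_fps x) * linear_fps x"
proof -
  have "expfactor J N (linear_fps x) = of_nat (J 1) * linear_fps x"
    by (simp add: expfactor_def rad_funpow_self if_distrib[of "\<lambda>y. _ * y"] cong: if_cong)
  then show ?thesis
    by (simp only: euler_fps_exp U_linear_fps[OF assms] U_J1)
qed

text \<open>The difference \<open>X\<close> solves the same linear equation. As \<open>w\<close> has
  no constant term, \<open>X * w\<close> starts one degree later than \<open>X\<close>, while
  \<open>euler X\<close> multiplies each coefficient by its degree, which can be cancelled; so the
  order of \<open>X\<close> grows past \<open>N\<close>.\<close>

lemma ode_unique:
  assumes "Y \<in> U 0" "Z \<in> U 0" "Y $ 0 = Z $ 0" "w \<in> U 1" "euler Y = Y * w" "euler Z = Z * w"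
  shows "Y = Z"
proof -
  define X where "X = Y - Z"
  have eX: "euler X = X * w"
    by (simp add: X_def euler_diff assms left_diff_distrib)
  have "X \<in> U (Suc k)" for k
  proof (induction k)
    case 0
    show ?case
      using U_diff[OF assms(1,2)] assms(3) by (auto simp: U_def X_def)
  next
    case (Suc k)
    have "X * w \<in> U (Suc k + 1)"
      using Suc assms(4) by (rule U_mult)
    then have "of_nat (Suc k) * X $ Suc k = 0"
      using U_lt[of "X * w" "Suc k + 1" "Suc k"] by (simp flip: eX)
    moreover have PX: "X $ Suc k \<in> P (Suc k)"
      using Suc by (rule U_P)
    ultimately have "X $ Suc k = 0"
      using P_big[of "Suc k"] P_cancel[of _ k] P_mono[of 1 "Suc k"] by (cases "Suc k \<le> N") auto
    then show ?case
      using Suc by (auto simp: U_def less_Suc_eq)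
  qed
  then have "X = 0"
    using U_big by blast
  then show ?thesis
    by (simp add: X_def)
qed

section \<open>Setting t = 1\<close>

definition eval1 :: "'r fps \<Rightarrow> 'r" where
  "eval1 f = (\<Sum>k\<le>N. f $ k)"

text \<open>The products dropped by the truncation have total degree above \<open>N\<close> and
  vanish by the filtration.\<close>

lemma eval1_mult:
  assumes "f \<in> U 0" "h \<in> U 0"
  shows "eval1 (f * h) = eval1 f * eval1 h"
proof -
  have "f $ i * h $ j = 0" if "i + j > N" for i j
    using P_big[OF that P_mult[OF U_P[OF assms(1)] U_P[OF assms(2)]]] .
  then have *: "f $ j * h $ i = 0" if "i + j > N" for i j
    using that by (simp add: add.commute)
  have "eval1 (f * h) = (\<Sum>k\<le>N. \<Sum>j\<le>k. f $ j * h $ (k - j))"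
    by (simp add: eval1_def fps_mult_nth atLeast0AtMost)
  also have "\<dots> = (\<Sum>i\<le>N. \<Sum>j\<le>N. f $ j * h $ i)"
    using sum_triangle_eq_square[of N "\<lambda>i j. f $ j * h $ i"] * by blast
  also have "\<dots> = eval1 f * eval1 h"
    unfolding eval1_def sum_product by (rule sum.swap)
  finally show ?thesis .
qed

lemma eval1_one: "eval1 1 = 1"
  by (simp add: eval1_def)

lemma eval1_power: "f \<in> U 0 \<Longrightarrow> eval1 (f ^ k) = eval1 f ^ k"
  by (induction k) (simp_all add: eval1_one eval1_mult U_power0)

lemma eval1_exp:
  assumes "f \<in> U 0"
  shows "eval1 (ex f) = ex (eval1 f)"
proof -
  have "eval1 (ex f) = (\<Sum>j\<le>N. eval1 (of_nat (J j) * f ^ j))"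
    unfolding trunc_exp_def eval1_def fps_sum_nth by (rule sum.swap)
  also have "\<dots> = (\<Sum>j\<le>N. of_nat (J j) * eval1 (f ^ j))"
    by (simp add: eval1_def sum_distrib_left)
  finally show ?thesis
    by (simp add: trunc_exp_def eval1_power assms)
qed

lemma eval1_linear_fps: "x \<in> P 1 \<Longrightarrow> eval1 (linear_fps x) = x"
  using P_big[of 1 x] by (cases "1 \<le> N") (auto simp: eval1_def)

lemma fps_exp_nth_0: "c \<in> U 1 \<Longrightarrow> ex c $ 0 = 1"
proof -
  assume c: "c \<in> U 1"
  have "c ^ k $ 0 = (if k = 0 then 1 else 0)" for k
    using U_lt[OF U_power[OF c, of k], of 0] by auto
  then show ?thesis
    using J by (simp add: trunc_exp_def fps_sum_nth inverse_factorials_def if_distrib[of "\<lambda>y. _ * y"] cong: if_cong)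
qed

text \<open>The series e^{-tx} e^{tx} has Euler derivative 0 and constant term 1, so it is 1 by
  \<open>ode_unique\<close> with \<open>w = 0\<close>.\<close>

lemma exp_uminus:
  assumes x: "x \<in> P 1"
  shows "ex (- x) * ex x = 1"
proof -
  let ?a = "linear_fps x"
  note a = U_linear_fps[OF x] and a' = U_linear_fps[OF P_uminus[OF x]]
  note a0 = U_mono[OF _ a, of 0, simplified] and a0' = U_mono[OF _ a', of 0, simplified]
  let ?Y = "ex (linear_fps (- x)) * ex ?a"
  have comm: "?a * ex ?a = ex ?a * ?a"
    unfolding trunc_exp_def sum_distrib_left sum_distrib_right
    by (intro sum.cong refl) (metis mult.assoc mult_of_nat_commute power_commutes)
  have "euler ?Y = ?Y * 0"
    by (simp only: euler_mult euler_fps_exp_linear[OF x] euler_fps_exp_linear[OF P_uminus[OF x]])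
      (simp add: linear_fps_uminus mult.assoc comm)
  moreover have "euler 1 = 1 * (0 :: 'r fps)"
    by (simp add: fps_eq_iff)
  moreover have "?Y \<in> U 0"
    using U_mult[OF U_trunc_exp[OF a0'] U_trunc_exp[OF a0]] by simp
  moreover have "?Y $ 0 = 1 $ 0"
    by (simp only: fps_mult_nth_0 fps_exp_nth_0[OF a] fps_exp_nth_0[OF a'] mult_1 fps_one_nth simp_thms if_True)
  ultimately have "?Y = 1"
    using ode_unique[OF _ U_one _ U_zero] by blast
  then have "eval1 ?Y = 1"
    by (simp only: eval1_one)
  then show ?thesis
    by (simp only: eval1_mult[OF U_trunc_exp[OF a0'] U_trunc_exp[OF a0]] eval1_exp a0 a0'
        eval1_linear_fps[OF x] eval1_linear_fps[OF P_uminus[OF x]])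
qed

text \<open>Isolates the linear term; the rest of the series keeps a right factor \<open>x\<close>
  and a left factor in \<open>P 1\<close>. This later compares W(a) with a.\<close>

lemma exp_expand:
  assumes x: "x \<in> P 1"
  obtains h where "h \<in> P 1" "ex x = 1 + x + h * x"
proof (cases N)
  case 0
  then have "x = 0"
    using P_big[OF _ x] by simp
  then show ?thesis
    using that[of 0] J 0 by (simp add: P_zero trunc_exp_def inverse_factorials_def)
next
  case (Suc M)
  define h where "h = (\<Sum>k<M. of_nat (J (Suc (Suc k))) * x ^ Suc k)"
  have "x ^ Suc k \<in> P 1" for k
    using P_mono[OF _ P_power[OF x], of 1 "Suc k"] by simp
  then have "h \<in> P 1"
    unfolding h_def by (intro P_sum P_of_nat)
  moreover have "ex x = of_nat (J 0) + of_nat (J 1) * x + h * x"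
    unfolding trunc_exp_def h_def Suc sum_distrib_right
    by (subst sum.atMost_Suc_shift, subst sum.atMost_shift) (simp add: mult.assoc power_commutes)
  ultimately show ?thesis
    using that[of h] P_J1[OF x] J by (simp add: inverse_factorials_def)
qed

lemma exp_minus_1: "x \<in> P 1 \<Longrightarrow> ex x - 1 \<in> P 1"
proof -
  assume x: "x \<in> P 1"
  then obtain h where h: "h \<in> P 1" "ex x = 1 + x + h * x"
    using exp_expand by blast
  have "h * x \<in> P 1"
    using P_mono[OF _ P_mult[OF h(1) x], of 1] by simp
  then show ?thesis
    using P_add[OF x] by (simp add: h(2))
qed

lemma P_power_diff:
  assumes "x \<in> P 1" "y \<in> P 1" "x - y \<in> P k"
  shows "x ^ Suc j - y ^ Suc j \<in> P (k + j)"
proof (induction j)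
  case 0
  show ?case using assms by simp
next
  case (Suc j)
  have "x ^ Suc (Suc j) - y ^ Suc (Suc j) = x * (x ^ Suc j - y ^ Suc j) + (x - y) * y ^ Suc j"
    by (simp add: algebra_simps)
  moreover have "x * (x ^ Suc j - y ^ Suc j) \<in> P (k + Suc j)"
    using P_mult[OF assms(1) Suc] by simp
  moreover have "(x - y) * y ^ Suc j \<in> P (k + Suc j)"
    by (intro P_mult assms P_power)
  ultimately show ?case
    using P_add by metis
qed

text \<open>Successive approximation: if \<open>x - y\<close> lies in \<open>P k\<close>,
  differences of higher powers lie one level deeper, and equality of the exponentials passes this on
  to \<open>x - y\<close>.\<close>

lemma exp_inj:
  assumes x: "x \<in> P 1" and y: "y \<in> P 1" and eq: "ex x = ex y"
  shows "x = y"
proof -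
  have "x - y \<in> P (Suc k)" for k
  proof (induction k)
    case 0
    show ?case using P_diff[OF x y] by simp
  next
    case (Suc k)
    show ?case
    proof (cases N)
      case 0
      then have "x = 0" "y = 0"
        using P_big[OF _ x] P_big[OF _ y] by simp_all
      then show ?thesis
        by (simp add: P_zero)
    next
      case (Suc M)
      let ?d = "\<lambda>j. of_nat (J j) * (x ^ j - y ^ j)"
      have "0 = (\<Sum>j\<le>N. ?d j)"
        using eq by (simp add: trunc_exp_def sum_subtractf right_diff_distrib)
      also have "\<dots> = (\<Sum>j\<le>M. ?d (Suc j))"
        unfolding Suc by (subst sum.atMost_Suc_shift) simp
      also have "\<dots> = ?d 1 + (\<Sum>j<M. ?d (Suc (Suc j)))"
        by (subst sum.atMost_shift) simp
      finally have "x - y = - (\<Sum>j<M. ?d (Suc (Suc j)))"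
        using P_J1[OF P_diff[OF x y]] by (simp add: eq_neg_iff_add_eq_0)
      moreover have "?d (Suc (Suc j)) \<in> P (Suc (Suc k))" for j
        using P_power_diff[OF x y Suc.IH, of "Suc j"]
        by (intro P_of_nat P_mono[of "Suc (Suc k)" "Suc k + Suc j"]) auto
      ultimately show ?thesis
        by (simp only:) (intro P_uminus P_sum; simp)
    qed
  qed
  then have "x - y = 0"
    using P_vanish by blast
  then show ?thesis by simp
qed

end

text \<open>The Lie subring \<open>g\<close> need not be closed under products; in the application
  it consists of the operators L_a.\<close>

locale filtered_lie_ring = filtered_ring +
  fixes g
  assumes g_zero: "0 \<in> g"
    and g_diff: "x \<in> g \<Longrightarrow> y \<in> g \<Longrightarrow> x - y \<in> g"
    and g_bracket: "x \<in> g \<Longrightarrow> y \<in> g \<Longrightarrow> x * y - y * x \<in> g"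
    and g_P: "g \<subseteq> P 1"
begin

lemma g_add: "x \<in> g \<Longrightarrow> y \<in> g \<Longrightarrow> x + y \<in> g"
  using g_diff[of x "0 - y"] g_diff[OF g_zero, of y] by simp

lemma g_sum: "(\<And>i. i \<in> A \<Longrightarrow> f i \<in> g) \<Longrightarrow> sum f A \<in> g"
  by (induction A rule: infinite_finite_induct) (auto intro: g_add g_zero)

lemma g_of_nat: "x \<in> g \<Longrightarrow> of_nat m * x \<in> g"
  by (induction m) (auto simp: distrib_right intro: g_add g_zero)

section \<open>Power series with coefficients in the Lie ring\<close>

definition lie_fps :: "'a fps set" where
  "lie_fps = {f. \<forall>k. f $ k \<in> g}"

lemma lie_fps_rad:
  assumes "c \<in> lie_fps" "x \<in> lie_fps"
  shows "rad c x \<in> lie_fps"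
proof -
  \<comment> \<open>Reversing the summation pairs \<open>x $ i\<close> with the same coefficient of
    \<open>c\<close> in both products, so each pair forms a commutator.\<close>
  have "(c * x) $ k = (\<Sum>i=0..k. c $ (k - i) * x $ i)" for k
    unfolding fps_mult_nth by (rule sum.reindex_bij_witness[of _ "\<lambda>i. k - i" "\<lambda>i. k - i"]) auto
  then have "rad c x $ k = (\<Sum>i=0..k. x $ i * c $ (k - i) - c $ (k - i) * x $ i)" for k
    by (simp add: rad_def fps_mult_nth sum_subtractf)
  then show ?thesis
    using assms by (auto simp: lie_fps_def intro!: g_sum g_bracket)
qed

lemma lie_fps_add: "f \<in> lie_fps \<Longrightarrow> h \<in> lie_fps \<Longrightarrow> f + h \<in> lie_fps"
  by (auto simp: lie_fps_def g_add)

lemma lie_fps_diff: "f \<in> lie_fps \<Longrightarrow> h \<in> lie_fps \<Longrightarrow> f - h \<in> lie_fps"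
  by (auto simp: lie_fps_def g_diff)

lemma lie_fps_euler: "f \<in> lie_fps \<Longrightarrow> euler f \<in> lie_fps"
  by (auto simp: lie_fps_def g_of_nat)

lemma lie_fps_sum_rad:
  assumes "c \<in> lie_fps" "x \<in> lie_fps"
  shows "(\<Sum>j\<le>k. of_nat (a j) * (rad c ^^ j) x) \<in> lie_fps"
proof -
  have "(rad c ^^ j) x \<in> lie_fps" for j
    by (induction j) (use assms lie_fps_rad in auto)
  then show ?thesis
    by (auto simp: lie_fps_def fps_sum_nth intro!: g_sum g_of_nat)
qed

lemma lie_fps_expfactor: "c \<in> lie_fps \<Longrightarrow> expfactor J N c \<in> lie_fps"
  unfolding expfactor_def by (intro lie_fps_sum_rad lie_fps_euler)

lemma U_sum_rad: "c \<in> U 1 \<Longrightarrow> x \<in> U 1 \<Longrightarrow> (\<Sum>j\<le>k. of_nat (a j) * (rad c ^^ j) x) \<in> U 1"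
  by (intro U_sum U_of_nat U_mono[OF _ U_rad_funpow]) auto

lemma U_expfactor: "c \<in> U 1 \<Longrightarrow> expfactor J N c \<in> U 1"
  unfolding expfactor_def by (intro U_sum_rad U_euler)

text \<open>Linearisation in \<open>d\<close>: the term \<open>j = 0\<close> changes by
  \<open>euler d\<close>, and every commutator pushes the other changes at least one degree
  further.\<close>

lemma expfactor_perturb:
  assumes c: "c \<in> U 1" and d: "d \<in> U (Suc k)"
  shows "expfactor J N (c + d) - expfactor J N c - euler d \<in> U (Suc (Suc k))"
proof -
  let ?y = "\<lambda>j. (rad c ^^ j) (euler c)" and ?z = "\<lambda>j. (rad (c + d) ^^ j) (euler (c + d))"
  have d1: "d \<in> U 1"
    using U_mono[OF _ d] by simp
  have cd: "c + d \<in> U 1"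
    by (intro U_add c d1)
  have diff: "?z j - ?y j \<in> U (Suc k + j)" for j
  proof (induction j)
    case 0
    then show ?case using U_euler[OF d] by (simp add: euler_add)
  next
    case (Suc j)
    have "?z (Suc j) - ?y (Suc j) = rad d (?z j) + rad c (?z j - ?y j)"
      by (simp add: rad_def algebra_simps)
    moreover have "rad d (?z j) \<in> U (Suc k + Suc j)"
      by (intro U_rad d U_rad_funpow cd U_euler)
    moreover have "rad c (?z j - ?y j) \<in> U (Suc k + Suc j)"
      using U_rad[OF c Suc] by simp
    ultimately show ?case
      using U_add by metis
  qed
  have "expfactor J N (c + d) - expfactor J N c = (\<Sum>j\<le>N. of_nat (J (Suc j)) * (?z j - ?y j))"
    by (simp add: expfactor_def sum_subtractf right_diff_distrib)
  also have "\<dots> = of_nat (J 1) * euler d + (\<Sum>j<N. of_nat (J (Suc (Suc j))) * (?z (Suc j) - ?y (Suc j)))"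
    by (subst sum.atMost_shift) (simp add: euler_add del: funpow.simps(2))
  finally have "expfactor J N (c + d) - expfactor J N c - euler d
      = (\<Sum>j<N. of_nat (J (Suc (Suc j))) * (?z (Suc j) - ?y (Suc j)))"
    using U_J1[OF U_euler[OF d1]] by simp
  moreover have "?z (Suc j) - ?y (Suc j) \<in> U (Suc (Suc k))" for j
    using U_mono[OF _ diff[of "Suc j"], of "Suc (Suc k)"] by simp
  ultimately show ?thesis
    by (simp only:) (intro U_sum U_of_nat; simp)
qed

text \<open>Solved degree by degree: the leading coefficient of the residual, divided by its degree,
  corrects \<open>c\<close>, and by \<open>expfactor_perturb\<close> the new residual starts one
  degree later.\<close>

lemma expfactor_surj:
  assumes w: "w \<in> U 1" "w \<in> lie_fps"
  obtains c where "c \<in> U 1" "c \<in> lie_fps" "expfactor J N c = w"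
proof -
  have "\<exists>c. c \<in> U 1 \<and> c \<in> lie_fps \<and> w - expfactor J N c \<in> U (Suc k)" for k
  proof (induction k)
    case 0
    have "w - expfactor J N 0 \<in> U 1"
      by (intro U_diff w U_expfactor U_zero)
    then show ?case
      using U_zero[of 1] g_zero by (intro exI[of _ 0]) (auto simp: lie_fps_def)
  next
    case (Suc k)
    then obtain c where c: "c \<in> U 1" "c \<in> lie_fps" "w - expfactor J N c \<in> U (Suc k)"
      by blast
    define r where "r = w - expfactor J N c"
    have r: "r \<in> U (Suc k)" "r \<in> lie_fps"
      using c w by (auto simp: r_def intro: lie_fps_diff lie_fps_expfactor)
    show ?case
    proof (cases "Suc k \<le> N")
      case False
      then have "r = 0"
        using U_big[OF r(1)] by simp
      then show ?thesis
        using c U_zero by (auto simp: r_def)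
    next
      case True
      \<comment> \<open>Division by k+1 is multiplication by an integer, so the correction stays in
        \<open>g\<close>.\<close>
      define x where "x = of_nat (J (Suc k) * fact k) * r $ Suc k"
      define d where "d = Abs_fps (\<lambda>i. if i = Suc k then x else 0)"
      have x: "x \<in> P (Suc k)" "x \<in> g"
        unfolding x_def using r U_P[OF r(1)] by (auto intro!: P_of_nat g_of_nat simp: lie_fps_def simp del: of_nat_mult)
      have d: "d \<in> U (Suc k)" "d \<in> lie_fps"
        using x P_zero g_zero by (auto simp: d_def U_def lie_fps_def)
      have "r $ Suc k \<in> P 1"
        using U_P[OF r(1)] P_mono[of 1 "Suc k"] by simp
      then have "of_nat (Suc k) * x = r $ Suc k"
        unfolding x_def using True by (rule P_divide)
      then have "(r - euler d) $ Suc k = 0"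
        by (simp add: d_def)
      moreover have "r - euler d \<in> U (Suc k)"
        by (intro U_diff r U_euler d)
      ultimately have rd: "r - euler d \<in> U (Suc (Suc k))"
        by (auto simp: U_def less_Suc_eq)
      have "w - expfactor J N (c + d) = r - euler d - (expfactor J N (c + d) - expfactor J N c - euler d)"
        by (simp add: r_def)
      also have "\<dots> \<in> U (Suc (Suc k))"
        by (intro U_diff rd expfactor_perturb c d)
      finally show ?thesis
        using c d U_mono[OF _ d(1), of 1] by (intro exI[of _ "c + d"]) (auto intro: U_add lie_fps_add)
    qed
  qed
  then obtain c where c: "c \<in> U 1" "c \<in> lie_fps" "w - expfactor J N c \<in> U (Suc N)"
    by blast
  then have "w - expfactor J N c = 0"
    using U_big by blast
  then show ?thesis
    using c that by simp
qed

text \<open>No explicit Baker-Campbell-Hausdorff series is needed: e^{ta} e^{tb} has a Lie series as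
  logarithmic derivative, and \<open>expfactor_surj\<close> supplies a Lie series \<open>c\<close>
  for which e^c has the same one.\<close>

theorem exp_mult_closed:
  assumes a: "a \<in> g" and b: "b \<in> g"
  obtains c where "c \<in> g" "ex a * ex b = ex c"
proof -
  let ?a = "linear_fps a" and ?b = "linear_fps b"
  have P: "a \<in> P 1" "b \<in> P 1"
    using a b g_P by auto
  note U1 = U_linear_fps[OF P(1)] U_linear_fps[OF P(2)]
  have U0: "?a \<in> U 0" "?b \<in> U 0"
    using U_mono[of 0 1] U1 by simp_all
  \<comment> \<open>This is e^{-tb} (ta) e^{tb}, expanded in commutators.\<close>
  define u where "u = (\<Sum>j\<le>N. of_nat (J j) * (rad ?b ^^ j) ?a)"
  have lie: "?a \<in> lie_fps" "?b \<in> lie_fps"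
    using a b g_zero by (auto simp: lie_fps_def)
  have w: "u + ?b \<in> U 1" "u + ?b \<in> lie_fps"
    unfolding u_def by (intro U_add U_sum_rad U1 lie_fps_add lie_fps_sum_rad lie)+
  obtain c where c: "c \<in> U 1" "c \<in> lie_fps" "expfactor J N c = u + ?b"
    using expfactor_surj[OF w] by blast
  have c0: "c \<in> U 0"
    using U_mono[OF _ c(1)] by simp
  let ?Y = "ex ?a * ex ?b"
  have "euler ?Y = ex ?a * (?a * ex ?b) + ?Y * ?b"
    by (simp only: euler_mult euler_fps_exp_linear[OF P(1)] euler_fps_exp_linear[OF P(2)] mult.assoc)
  also have "?a * ex ?b = ex ?b * u"
    unfolding u_def by (intro mult_fps_exp U1)
  finally have "euler ?Y = ?Y * (u + ?b)"
    by (simp add: mult.assoc distrib_left)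
  moreover have "euler (ex c) = ex c * (u + ?b)"
    using euler_fps_exp[OF c(1)] c(3) by simp
  moreover have "?Y \<in> U 0"
    using U_mult[OF U_trunc_exp U_trunc_exp, OF U0] by simp
  moreover have "?Y $ 0 = ex c $ 0"
    by (simp only: fps_mult_nth_0 fps_exp_nth_0[OF c(1)] fps_exp_nth_0[OF U1(1)] fps_exp_nth_0[OF U1(2)] mult_1)
  ultimately have "?Y = ex c"
    using ode_unique[OF _ U_trunc_exp[OF c0] _ w(1)] by blast
  then have "eval1 ?Y = eval1 (ex c)"
    by (rule arg_cong)
  then have "ex a * ex b = ex (eval1 c)"
    by (simp only: eval1_mult[OF U_trunc_exp U_trunc_exp, OF U0] eval1_exp U0 c0
        eval1_linear_fps[OF P(1)] eval1_linear_fps[OF P(2)])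
  moreover have "eval1 c \<in> g"
    using c(2) by (auto simp: eval1_def lie_fps_def intro: g_sum)
  ultimately show ?thesis
    using that by blast
qed

end

subsection \<open>Finite abelian groups and their endomorphisms\<close>

lemma nmul_0 [simp]: "nmul 0 x = 0"
  by (simp add: nmul_def)

lemma nmul_Suc: "nmul (Suc k) x = nmul k x + x"
  by (simp add: nmul_def)

lemma nmul_add: "nmul (k + l) x = nmul k x + nmul l x"
  by (induction l) (simp_all add: nmul_Suc add.assoc)

lemma nmul_mult: "nmul (k * l) x = nmul k (nmul l x)"
  by (induction k) (simp_all add: nmul_Suc nmul_add add.commute)

lemma nmul_zero [simp]: "nmul k 0 = 0"
  by (simp add: nmul_def)

lemma nmul_distrib: "nmul k (x + y) = nmul k x + nmul k y"
  by (simp add: nmul_def sum.distrib)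

lemma zmul_int_diff: "zmul (int a - int b) x = nmul a x - nmul b x"
proof (cases "a \<ge> b")
  case True
  then show ?thesis
    using nmul_add[of "a - b" b x] by (simp add: zmul_def nat_diff_distrib algebra_simps)
next
  case False
  then show ?thesis
    using nmul_add[of "b - a" a x] by (simp add: zmul_def nat_diff_distrib algebra_simps)
qed

lemma zmul_0 [simp]: "zmul 0 x = 0"
  by (simp add: zmul_def)

lemma zmul_1 [simp]: "zmul 1 x = x"
  by (simp add: zmul_def nmul_def)

lemma zmul_add: "zmul (k + l) x = zmul k x + zmul l x"
proof -
  obtain a b c d where kl: "k = int a - int b" "l = int c - int d"
    by (metis int_diff_cases)
  have "k + l = int (a + c) - int (b + d)"
    by (simp add: kl)
  then show ?thesis
    by (simp only: kl zmul_int_diff nmul_add) (simp add: algebra_simps)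
qed

lemma additive_diff:
  fixes h :: "'a::ab_group_add \<Rightarrow> 'b::ab_group_add"
  assumes "\<And>x y. h (x + y) = h x + h y"
  shows "h (x - y) = h x - h y"
  using assms[of "x - y" y] by simp

lemma zmul_distrib: "zmul k (x + y) = zmul k x + zmul k y"
  by (simp add: zmul_def nmul_distrib)

lemmas zmul_diff = additive_diff[of "zmul k" for k, OF zmul_distrib]

lemma additive_zmul:
  fixes h :: "'a::ab_group_add \<Rightarrow> 'b::ab_group_add"
  assumes add: "\<And>x y. h (x + y) = h x + h y"
  shows "h (zmul k x) = zmul k (h x)"
proof -
  have "h 0 = 0"
    using add[of 0 0] by simp
  then have "h (nmul a x) = nmul a (h x)" for a
    by (induction a) (simp_all add: nmul_Suc add)
  moreover obtain a b where "k = int a - int b"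
    by (metis int_diff_cases)
  ultimately show ?thesis
    by (simp add: zmul_int_diff additive_diff[of h, OF add])
qed

text \<open>Translation by \<open>x\<close> permutes the group, so the sum of all elements equals
  itself plus |A| times \<open>x\<close>.\<close>

lemma nmul_card:
  fixes x :: "'a::{ab_group_add,finite}"
  shows "nmul (card (UNIV :: 'a set)) x = 0"
proof -
  have "(\<Sum>y\<in>UNIV. y) = (\<Sum>y\<in>(UNIV :: 'a set). y + x)"
    by (rule sum.reindex_bij_witness[of _ "\<lambda>y. y + x" "\<lambda>y. y - x"]) auto
  also have "\<dots> = (\<Sum>y\<in>UNIV. y) + (\<Sum>y\<in>(UNIV :: 'a set). x)"
    by (simp add: sum.distrib)
  finally have "(\<Sum>y\<in>(UNIV :: 'a set). x) = 0"
    by simp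
  moreover have "(\<Sum>y\<in>S. x) = nmul (card S) x" if "finite S" for S :: "'a set"
    using that by (induction S) (simp_all add: nmul_Suc add.commute)
  ultimately show ?thesis
    by simp
qed

lemma nmul_cong:
  assumes "[a = b] (mod q)" "nmul q x = 0"
  shows "nmul a x = nmul b x"
proof -
  have "nmul a x = nmul (a mod q) x" for a
    by (subst div_mult_mod_eq[of a q, symmetric], subst nmul_add, subst nmul_mult) (simp add: assms(2))
  then show ?thesis
    using assms(1) by (metis cong_def)
qed

text \<open>Lagrange's theorem: the relation below partitions the group into translates of
  \<open>H\<close>.\<close>

lemma card_subgroup_dvd:
  fixes H :: "'a::{ab_group_add,finite} set"
  assumes "0 \<in> H" "\<And>x y. x \<in> H \<Longrightarrow> y \<in> H \<Longrightarrow> x - y \<in> H"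
  shows "card H dvd card (UNIV :: 'a set)"
proof -
  have uminus: "- x \<in> H" if "x \<in> H" for x
    using assms(2)[OF assms(1) that] by simp
  have add: "x + y \<in> H" if "x \<in> H" "y \<in> H" for x y
    using assms(2)[OF that(1) uminus[OF that(2)]] by simp
  let ?r = "{(x, y). y - x \<in> H}"
  have "equiv UNIV ?r"
  proof (rule equivI)
    show "refl ?r"
      by (auto simp: refl_on_def assms)
    show "sym ?r"
    proof (rule symI)
      fix x y
      assume "(x, y) \<in> ?r"
      then show "(y, x) \<in> ?r"
        using uminus[of "y - x"] by simp
    qed
    show "trans ?r"
    proof (rule transI)
      fix x y z
      assume "(x, y) \<in> ?r" "(y, z) \<in> ?r"
      then show "(x, z) \<in> ?r"
        using add[of "z - y" "y - x"] by simp
    qed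
  qed simp
  moreover have "card H dvd card X" if X: "X \<in> UNIV // ?r" for X
  proof -
    obtain x where "X = ?r `` {x}"
      using X by (rule quotientE)
    then have "X = {y. y - x \<in> H}"
      by auto
    also have "\<dots> = (\<lambda>h. x + h) ` H"
      by (rule set_eqI, rule iffI, rule_tac x = "xa - x" in image_eqI) auto
    finally show ?thesis
      by (simp add: card_image)
  qed
  ultimately show ?thesis
    by (rule equiv_imp_dvd_card[OF finite_UNIV])
qed

text \<open>The additive maps of A x Z get a type of their own so that they form an instance of
  \<open>ring_1\<close> and can serve as coefficients of power series.\<close>

typedef (overloaded) 'a vend =
  "{f :: 'a::ab_group_add \<times> int \<Rightarrow> 'a \<times> int. \<forall>x y. f (x + y) = f x + f y}"
  morphisms app Vend
  by (intro exI[of _ "\<lambda>x. x"]) simp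

setup_lifting type_definition_vend

lemma app_add: "app f (x + y) = app f x + app f y"
  using app[of f] by blast

lemma vend_eqI: "(\<And>v. app f v = app h v) \<Longrightarrow> f = h"
  by (simp add: ext flip: app_inject)

instantiation vend :: (ab_group_add) ring_1
begin

lift_definition zero_vend :: "'a vend" is "\<lambda>_. 0" by simp
lift_definition one_vend :: "'a vend" is "\<lambda>x. x" by simp
lift_definition plus_vend :: "'a vend \<Rightarrow> 'a vend \<Rightarrow> 'a vend" is "\<lambda>f g x. f x + g x"
  by (simp add: algebra_simps)
lift_definition minus_vend :: "'a vend \<Rightarrow> 'a vend \<Rightarrow> 'a vend" is "\<lambda>f g x. f x - g x"
  by (simp add: algebra_simps)
lift_definition uminus_vend :: "'a vend \<Rightarrow> 'a vend" is "\<lambda>f x. - f x"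
  by simp
lift_definition times_vend :: "'a vend \<Rightarrow> 'a vend \<Rightarrow> 'a vend" is "\<lambda>f g x. f (g x)"
  by simp

instance
proof
  fix a b c :: "'a vend"
  note rep = zero_vend.rep_eq one_vend.rep_eq plus_vend.rep_eq minus_vend.rep_eq
    uminus_vend.rep_eq times_vend.rep_eq
  show "a * b * c = a * (b * c)" "1 * a = a" "a * 1 = a" "a + b + c = a + (b + c)" "a + b = b + a"
    "0 + a = a" "- a + a = 0" "a - b = a + - b" "(a + b) * c = a * c + b * c" "a * (b + c) = a * b + a * c"
    by (rule vend_eqI, simp only: rep app_add add.assoc add_0_left left_minus diff_conv_add_uminus,
        (simp only: add.commute)?)+
  \<comment> \<open>The integer component separates 0 and 1 even when A is trivial.\<close>
  show "(0 :: 'a vend) \<noteq> 1"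
  proof
    assume "(0 :: 'a vend) = 1"
    then have "app 0 (0 :: 'a, 1) = app 1 (0 :: 'a, 1)"
      by simp
    then show False
      by (simp add: rep zero_prod_def)
  qed
qed

end

lemmas app_simps [simp] = zero_vend.rep_eq one_vend.rep_eq plus_vend.rep_eq minus_vend.rep_eq
  uminus_vend.rep_eq times_vend.rep_eq

lemma app_sum: "app (sum f A) v = (\<Sum>i\<in>A. app (f i) v)"
  by (induction A rule: infinite_finite_induct) auto

lemma app_power: "app (f ^ k) v = (app f ^^ k) v"
  by (induction k) auto

lemma app_of_nat: "app (of_nat k * f) v = nmul k (app f v)"
proof (induction k)
  case (Suc k)
  have "of_nat (Suc k) * f = of_nat k * f + f"
    by (simp add: distrib_right add.commute)
  then show ?case
    by (simp only: plus_vend.rep_eq Suc nmul_Suc)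
qed simp

lemma nmul_pair: "nmul k (x, 0) = (nmul k x, 0)"
  by (induction k) (simp_all add: nmul_Suc zero_prod_def)

subsection \<open>The group of flows\<close>

lemma addgen_diff: "x \<in> addgen S \<Longrightarrow> y \<in> addgen S \<Longrightarrow> x - y \<in> addgen S"
  using addgen.add[OF _ addgen.neg] by fastforce

lemma addgen_subset:
  assumes "S \<subseteq> H" "0 \<in> H" "\<And>x y. x \<in> H \<Longrightarrow> y \<in> H \<Longrightarrow> x - y \<in> H"
  shows "addgen S \<subseteq> H"
proof
  fix x
  assume "x \<in> addgen S"
  then show "x \<in> H"
  proof induction
    case (add x y)
    have "0 - y \<in> H"
      by (intro assms add)
    then show ?case
      using assms(3)[of x "0 - y"] add by simp
  next
    case (neg x)
    then show ?case
      using assms(3)[OF assms(2), of x] by simp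
  qed (use assms in auto)
qed

lemma lpow_zero: "0 \<in> lpow s i"
  by (induction s i rule: lpow.induct) (auto intro: addgen.zero)

lemma lpow_diff: "x \<in> lpow s i \<Longrightarrow> y \<in> lpow s i \<Longrightarrow> x - y \<in> lpow s i"
  by (induction s i rule: lpow.induct) (auto intro: addgen_diff)

lemma lpow_mult: "i \<ge> 1 \<Longrightarrow> b \<in> lpow s i \<Longrightarrow> s a b \<in> lpow s (Suc i)"
  by (cases i) (auto intro: addgen.gen)

lemma lpow_Suc_eq: "i \<ge> 1 \<Longrightarrow> lpow s (Suc i) = addgen {s a b | a b. b \<in> lpow s i}"
  by (cases i) auto

lemma lpow_Suc_subset: "lpow s (Suc i) \<subseteq> lpow s i"
proof (induction i)
  case (Suc i)
  show ?case
  proof (cases i)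
    case (Suc j)
    have "s a b \<in> lpow s (Suc i)" if "b \<in> lpow s (Suc i)" for a b
      using that Suc.IH Suc by (intro lpow_mult) auto
    then have "addgen {s a b | a b. b \<in> lpow s (Suc i)} \<subseteq> lpow s (Suc i)"
      by (intro addgen_subset lpow_zero lpow_diff) blast
    then show ?thesis
      by simp
  qed simp
qed simp

lemma lpow_antimono: "i \<le> j \<Longrightarrow> lpow s j \<subseteq> lpow s i"
  using lift_Suc_antimono_le[of "lpow s"] lpow_Suc_subset by blast

text \<open>Every strict inclusion in the chain of the powers costs a factor p in the order, so the chain
  reaches 0 after at most n strict steps.\<close>

lemma lpow_vanish:
  fixes s :: "'a::{ab_group_add,finite} \<Rightarrow> 'a \<Rightarrow> 'a"
  assumes "left_nilpotent s" "card (UNIV :: 'a set) = p ^ n" "prime p"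
  shows "lpow s (Suc n) = {0}"
proof -
  obtain N where N: "lpow s N = {0}"
    using assms(1) by (auto simp: left_nilpotent_def)
  \<comment> \<open>Each power determines the next, so a repetition makes the chain constant, with
    value 0. Index 0 is excluded because \<open>lpow s 0\<close> and \<open>lpow s 1\<close> agree
    by definition.\<close>
  have stable: "lpow s i = {0}" if "i \<ge> 1" "lpow s (Suc i) = lpow s i" for i
  proof -
    have "lpow s (i + k) = lpow s i" for k
    proof (induction k)
      case (Suc k)
      then show ?case
        using that lpow_Suc_eq[of "i + k" s] lpow_Suc_eq[of i s] by simp
    qed simp
    then have "lpow s i \<subseteq> lpow s N"
      using lpow_antimono[of N "i + N" s] by simp
    then show ?thesis
      using N lpow_zero[of s i] by auto
  qed
  have "lpow s (Suc i) = {0} \<or> (\<exists>e. card (lpow s (Suc i)) = p ^ e \<and> e + i \<le> n)" for i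
  proof (induction i)
    case 0
    then show ?case
      using assms(2) by auto
  next
    case (Suc i)
    show ?case
    proof (cases "lpow s (Suc (Suc i)) = lpow s (Suc i)")
      case True
      then show ?thesis
        using stable[of "Suc i"] by (simp del: lpow.simps)
    next
      case False
      then have less: "card (lpow s (Suc (Suc i))) < card (lpow s (Suc i))"
        using lpow_Suc_subset[of s "Suc i"] by (intro psubset_card_mono) (auto simp del: lpow.simps)
      have "card (lpow s (Suc (Suc i))) dvd p ^ n"
        using card_subgroup_dvd[OF lpow_zero lpow_diff, of s "Suc (Suc i)"] assms(2) by simp
      then obtain e where e: "card (lpow s (Suc (Suc i))) = p ^ e"
        using divides_primepow_nat[OF assms(3)] by blast
      have "p > 1"
        using assms(3) prime_gt_1_nat by blast
      show ?thesis
      proof (cases "lpow s (Suc i) = {0}")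
        case True
        then show ?thesis
          using less e \<open>p > 1\<close> by simp
      next
        case False
        then obtain e' where e': "card (lpow s (Suc i)) = p ^ e'" "e' + i \<le> n"
          using Suc by blast
        then have "e < e'"
          using less e \<open>p > 1\<close> by simp
        then show ?thesis
          using e e' by (intro disjI2 exI[of _ e]) auto
      qed
    qed
  qed
  from this[of n] show ?thesis
  proof
    assume "\<exists>e. card (lpow s (Suc n)) = p ^ e \<and> e + n \<le> n"
    then have "card (lpow s (Suc n)) = 1"
      by auto
    then show ?thesis
      using lpow_zero[of s "Suc n"] by (auto simp: card_1_singleton_iff simp del: lpow.simps)
  qed
qed

locale flow =
  fixes m :: "'a::{ab_group_add,finite} \<Rightarrow> 'a \<Rightarrow> 'a" and p n :: nat
  assumes pre_lie: "pre_lie m"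
    and left_nilpotent: "left_nilpotent m"
    and card: "card (UNIV :: 'a set) = p ^ n"
    and prime: "prime p"
    and p_ge: "p \<ge> n + 2"
begin

lemma m_add_left: "m (x + y) z = m x z + m y z"
  and m_add_right: "m x (y + z) = m x y + m x z"
  and m_assoc_sym: "m (m x y) z - m x (m y z) = m (m y x) z - m y (m x z)"
  using pre_lie by (simp_all add: pre_lie_def)

lemma m_diff_left: "m (x - y) z = m x z - m y z"
  using m_add_left by (rule additive_diff)

lemma lpow_n: "lpow m (Suc n) = {0}"
  using lpow_vanish[OF left_nilpotent card prime] .

section \<open>Left multiplications and the filtration\<close>

definition ell :: "'a \<Rightarrow> 'a vend" where
  "ell a = Vend (Lop m a)"

lemma Lop_pair: "Lop m a (x, k) = (m a x + zmul k a, 0)"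
  by (simp add: Lop_def id_mult_def)

lemma app_ell: "app (ell a) = Lop m a"
  unfolding ell_def by (rule Vend_inverse) (auto simp: Lop_pair m_add_right zmul_add)

lemma ell_diff: "ell (a - b) = ell a - ell b"
  by (rule vend_eqI) (auto simp: app_ell Lop_pair m_diff_left zmul_diff)

lemma ell_zero: "ell 0 = 0"
  using ell_diff[of 0 0] by simp

lemma ell_uminus: "ell (- a) = - ell a"
  using ell_diff[of 0 a] by (simp add: ell_zero)

text \<open>On A this is the pre-Lie identity; on the adjoined 1 both sides give a.b - b.a
  directly.\<close>

lemma ell_bracket: "ell a * ell b - ell b * ell a = ell (m a b - m b a)"
proof (rule vend_eqI)
  fix v :: "'a \<times> int"
  obtain x k where v: "v = (x, k)"
    by fastforce
  have "m a (m b x) - m b (m a x) = m (m a b) x - m (m b a) x"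
    using m_assoc_sym[of a b x] by (simp add: algebra_simps)
  then show "app (ell a * ell b - ell b * ell a) v = app (ell (m a b - m b a)) v"
    by (simp add: v app_ell Lop_pair m_add_right additive_zmul[of "m _"] m_diff_left zmul_diff)
qed

text \<open>The adjoined 1 makes the representation faithful, as L_a sends it to a.\<close>

lemma ell_inj: "ell a = ell b \<Longrightarrow> a = b"
proof -
  assume "ell a = ell b"
  then have "app (ell a) (0, 1) = app (ell b) (0, 1)"
    by simp
  moreover have "m c 0 = 0" for c
    using m_add_right[of c 0 0] by simp
  ultimately show ?thesis
    by (simp add: app_ell Lop_pair)
qed

definition J :: "nat \<Rightarrow> nat" where
  "J k = (if k = 0 then 1 else SOME j. [fact k * j = 1] (mod p ^ n))"

text \<open>For \<open>k\<close> up to \<open>n < p\<close> the prime \<open>p\<close> does not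
  divide k!.\<close>

lemma J_inverse_factorials: "inverse_factorials (p ^ n) n J"
proof -
  have "[fact k * J k = 1] (mod p ^ n)" if "k \<le> n" for k
  proof (cases "k = 0")
    case False
    have "\<not> p dvd fact k"
      using prime_dvd_fact_iff[OF prime] that p_ge by simp
    then have "coprime (fact k) (p ^ n)"
      using prime by (simp add: prime_imp_coprime coprime_commute)
    then have "\<exists>j. [fact k * j = 1] (mod p ^ n)"
      using cong_solve_coprime_nat[of "fact k" "p ^ n"] by simp
    then show ?thesis
      using False someI_ex[of "\<lambda>j. [fact k * j = 1] (mod p ^ n)"] by (simp only: J_def if_False)
  qed (simp add: J_def)
  then show ?thesis
    by (simp add: inverse_factorials_def J_def)
qed

text \<open>The chain A x Z, A, A^2, and so on. The extra step at index 0 lets L_a raise the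
  filtration on the adjoined 1 as well.\<close>

definition V :: "nat \<Rightarrow> ('a \<times> int) set" where
  "V i = (if i = 0 then UNIV else lpow m i \<times> {0})"

definition P :: "nat \<Rightarrow> 'a vend set" where
  "P k = {f. \<forall>i. \<forall>v\<in>V i. app f v \<in> V (i + k)}"

lemma P_I: "(\<And>i v. v \<in> V i \<Longrightarrow> app f v \<in> V (i + k)) \<Longrightarrow> f \<in> P k"
  by (simp add: P_def)

lemma P_D: "f \<in> P k \<Longrightarrow> v \<in> V i \<Longrightarrow> app f v \<in> V (i + k)"
  by (simp add: P_def)

lemma V_diff: "v \<in> V i \<Longrightarrow> w \<in> V i \<Longrightarrow> v - w \<in> V i"
  by (auto simp: V_def lpow_diff split: if_splits)

lemma V_Suc: "V (Suc i) \<subseteq> V i"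
  using lpow_Suc_subset[of m i] by (auto simp: V_def simp del: lpow.simps)

lemma ell_P: "ell a \<in> P 1"
proof -
  have "Lop m a v \<in> V (Suc i)" if "v \<in> V i" for i v
    using that lpow_mult[of i _ m a] by (cases v; cases i) (auto simp: V_def Lop_pair simp del: lpow.simps(3))
  then show ?thesis
    by (simp add: P_def app_ell)
qed

sublocale filtered_lie_ring P n "p ^ n" J "range ell"
proof
  fix x y :: "'a vend" and i j k :: nat
  show "0 \<in> P k"
    by (auto simp: P_def V_def lpow_zero zero_prod_def)
  show "x - y \<in> P k" if "x \<in> P k" "y \<in> P k"
    by (rule P_I) (simp add: V_diff P_D that)
  show "1 \<in> P 0"
    by (simp add: P_def)
  show "x * y \<in> P (i + j)" if "x \<in> P i" "y \<in> P j"
    by (rule P_I) (use P_D[OF that(1) P_D[OF that(2)]] in \<open>simp add: ac_simps\<close>)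
  show "P (Suc k) \<subseteq> P k"
  proof (intro subsetI P_I)
    fix f i v
    assume "f \<in> P (Suc k)" "v \<in> V i"
    then have "app f v \<in> V (Suc (i + k))"
      using P_D[of f "Suc k" v i] by simp
    then show "app f v \<in> V (i + k)"
      using V_Suc by blast
  qed
  show "x = 0" if "x \<in> P (Suc n)"
  proof (rule vend_eqI)
    fix v
    have "v \<in> V 0"
      by (simp add: V_def)
    then have "app x v \<in> V (0 + Suc n)"
      using that unfolding P_def by blast
    then show "app x v = app 0 v"
      by (auto simp: V_def lpow_n zero_prod_def simp del: lpow.simps)
  qed
  \<comment> \<open>An operator in \<open>P 1\<close> has its image in A x {0}, which is killed by
    the order of A.\<close>
  show "of_nat (p ^ n) * x = 0" if "x \<in> P 1"
  proof (rule vend_eqI)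
    fix v
    have "v \<in> V 0"
      by (simp add: V_def)
    then have "app x v \<in> V (0 + 1)"
      using that unfolding P_def by blast
    then obtain z where "app x v = (z, 0)"
      by (auto simp: V_def)
    then show "app (of_nat (p ^ n) * x) v = app 0 v"
      using nmul_card[of z] by (simp only: app_of_nat nmul_pair card) (simp add: zero_prod_def)
  qed
  show "inverse_factorials (p ^ n) n J"
    by (rule J_inverse_factorials)
  show "0 \<in> range ell"
    using rangeI[of ell 0] by (simp only: ell_zero)
  show "x - y \<in> range ell" if "x \<in> range ell" "y \<in> range ell"
    using that by (auto simp flip: ell_diff)
  show "x * y - y * x \<in> range ell" if "x \<in> range ell" "y \<in> range ell"
    using that by (auto simp: ell_bracket)
  show "range ell \<subseteq> P 1"
    using ell_P by blast
qed

section \<open>Exponential operators and the map W\<close>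

definition flowmap :: "'a \<Rightarrow> 'a vend" where
  "flowmap a = ex (ell a)"

lemma divnat_fact:
  fixes x :: 'a
  assumes "k \<le> n"
  shows "divnat (fact k) x = nmul (J k) x"
proof -
  have 1: "nmul (fact k * J k) z = z" for z :: 'a
    using nmul_cong[of "fact k * J k" 1 "p ^ n" z] J_inverse_factorials assms nmul_card[of z]
    by (simp add: inverse_factorials_def card nmul_Suc)
  show ?thesis
    unfolding divnat_def
  proof (rule the_equality)
    show "nmul (fact k) (nmul (J k) x) = x"
      using 1 by (simp only: nmul_mult)
    show "y = nmul (J k) x" if "nmul (fact k) y = x" for y
      using 1[of y] that by (simp only: mult.commute[of "fact k"] nmul_mult)
  qed
qed

text \<open>From the first power of L_a on, the integer component is 0, so \<open>fst\<close> loses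
  nothing; the term \<open>j = 0\<close> is \<open>v\<close> itself because
  \<open>J 0 = 1\<close>.\<close>

lemma expL_eq: "expL m n a v = app (flowmap a) v"
proof -
  have 1: "app (of_nat (J j) * ell a ^ j) v = (divnat (fact j) (fst ((Lop m a ^^ j) v)), 0)"
    if j: "j \<in> {1..n}" for j
  proof -
    obtain i where "j = Suc i"
      using j by (cases j) auto
    then have "snd (app (ell a ^ j) v) = 0"
      by (cases "app (ell a ^ i) v") (simp add: app_ell Lop_pair)
    then have "app (ell a ^ j) v = (fst ((Lop m a ^^ j) v), 0)"
      by (simp add: prod_eq_iff app_power app_ell)
    then show ?thesis
      using j by (simp only: app_of_nat nmul_pair) (simp add: divnat_fact)
  qed
  have "{..n} = insert 0 {1..n}"
    by auto
  then have "app (flowmap a) v = v + (\<Sum>j\<in>{1..n}. app (of_nat (J j) * ell a ^ j) v)"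
    by (simp add: flowmap_def trunc_exp_def app_sum J_def)
  also have "(\<Sum>j\<in>{1..n}. app (of_nat (J j) * ell a ^ j) v)
      = (\<Sum>j\<in>{1..n}. (divnat (fact j) (fst ((Lop m a ^^ j) v)), 0))"
    by (rule sum.cong[OF refl 1])
  also have "\<dots> = (\<Sum>j\<in>{1..n}. divnat (fact j) (fst ((Lop m a ^^ j) v)), 0)"
    by (simp add: sum_prod)
  finally show ?thesis
    by (simp add: expL_def id_add_def prod_eq_iff)
qed

lemma flowmap_diff_V: "v \<in> V i \<Longrightarrow> app (flowmap a) v - v \<in> V (Suc i)"
  using P_D[OF exp_minus_1[OF ell_P[of a]], of v i] by (simp add: flowmap_def)

lemma snd_flowmap: "snd (app (flowmap a) v) = snd v"
  by (simp add: expL_def id_add_def flip: expL_eq)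

lemma Wmap_eq: "app (flowmap a) (0, 1) = (Wmap m n a, 1)"
  using snd_flowmap[of a "(0, 1)"] by (simp add: Wmap_def id_add_def expL_eq prod_eq_iff)

lemma flowmap_mult: obtains c where "flowmap a * flowmap b = flowmap c"
  unfolding flowmap_def by (rule exp_mult_closed[OF rangeI rangeI]) (erule rangeE, simp)

lemma flowmap_zero: "flowmap 0 = 1"
  unfolding flowmap_def ell_zero by (rule exp_expand[OF P_zero]) simp

lemma flowmap_uminus: "flowmap (- a) * flowmap a = 1"
  unfolding flowmap_def ell_uminus by (rule exp_uminus[OF ell_P])

lemma flowmap_inj: "flowmap a = flowmap b \<Longrightarrow> a = b"
  unfolding flowmap_def by (rule ell_inj[OF exp_inj[OF ell_P ell_P]])

text \<open>By \<open>exp_expand\<close>, W(a) = a + h(a) with \<open>h\<close> in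
  \<open>P 1\<close>. So W(a) = 0 gives a = -h(a), which pushes \<open>a\<close> down the whole
  filtration.\<close>

lemma Wmap_eq_0:
  assumes "Wmap m n a = 0"
  shows "a = 0"
proof -
  obtain h where h: "h \<in> P 1" "flowmap a = 1 + ell a + h * ell a"
    unfolding flowmap_def using exp_expand[OF ell_P] by blast
  have "m a 0 = 0"
    using m_add_right[of a 0 0] by simp
  then have "(0, 1) + (a, 0) + app h (a, 0) = (0, 1)"
    using assms Wmap_eq[of a] by (simp add: h(2) app_ell Lop_pair)
  then have eq: "(a, 0) = 0 - app h (a, 0)"
    by (cases "app h (a, 0)") (simp add: zero_prod_def eq_neg_iff_add_eq_0)
  have "(a, 0) \<in> V (Suc i)" for i
  proof (induction i)
    case (Suc i)
    have "app h (a, 0) \<in> V (Suc (Suc i))"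
      using P_D[OF h(1) Suc] by simp
    moreover have "0 \<in> V (Suc (Suc i))"
      by (simp add: V_def lpow_zero zero_prod_def del: lpow.simps)
    ultimately show ?case
      by (subst eq) (rule V_diff)
  qed (simp add: V_def)
  from this[of n] show ?thesis
    by (auto simp: V_def lpow_n simp del: lpow.simps)
qed

text \<open>Two flows that agree on (0,1) differ by a flow fixing it, which is trivial by
  \<open>Wmap_eq_0\<close>.\<close>

lemma Wmap_inj: "inj (Wmap m n)"
proof (rule injI)
  fix a b
  assume W: "Wmap m n a = Wmap m n b"
  obtain c where c: "flowmap (- a) * flowmap b = flowmap c"
    using flowmap_mult by blast
  have "app (flowmap c) (0, 1) = app (flowmap (- a) * flowmap a) (0, 1)"
    by (simp add: Wmap_eq W flip: c)
  then have "Wmap m n c = 0"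
    by (simp add: flowmap_uminus Wmap_eq)
  then have "c = 0"
    by (rule Wmap_eq_0)
  then have 1: "flowmap (- a) * flowmap b = 1"
    by (simp only: c flowmap_zero)
  have "flowmap a * (flowmap (- a) * flowmap b) = flowmap b"
    using flowmap_uminus[of "- a"] by (simp flip: mult.assoc)
  then have "flowmap a = flowmap b"
    by (simp add: 1)
  then show "a = b"
    by (rule flowmap_inj)
qed

text \<open>A is finite, so injectivity of W gives surjectivity.\<close>

lemma Wmap_Omega: "Wmap m n (Omega m n a) = a"
  unfolding Omega_def using finite_UNIV_inj_surj[OF _ Wmap_inj] by (simp add: surj_f_inv_f)

lemma Omega_Wmap: "Omega m n (Wmap m n a) = a"
  unfolding Omega_def by (rule inv_f_f[OF Wmap_inj])

section \<open>The transported group law\<close>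

abbreviation circ :: "'a \<Rightarrow> 'a \<Rightarrow> 'a" where
  "circ \<equiv> flow_circ m n"

definition F :: "'a \<Rightarrow> 'a vend" where
  "F a = flowmap (Omega m n a)"

text \<open>Additivity on (b,1) = (0,1) + (b,0) yields the affine form of
  \<open>circ\<close>.\<close>

lemma F_point: "app (F a) (b, 1) = (circ a b, 1)"
proof -
  have "(b, 1) = (0, 1) + (b, 0 :: int)"
    by simp
  then have "app (F a) (b, 1) = (a, 1) + app (F a) (b, 0)"
    by (simp only: app_add F_def Wmap_eq Wmap_Omega)
  then show ?thesis
    using snd_flowmap[of "Omega m n a" "(b, 0)"]
    by (simp add: F_def flow_circ_def expL_eq prod_eq_iff)
qed

lemma F_eqI:
  assumes "app (flowmap c) (0, 1) = (a, 1)"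
  shows "flowmap c = F a"
  using assms Omega_Wmap[of c] by (simp add: F_def Wmap_eq)

lemma F_0: "F 0 = 1"
  using F_eqI[of 0 0] by (simp add: flowmap_zero)

lemma F_base: "app (F a) (0, 1) = (a, 1)"
  by (simp add: F_def Wmap_eq Wmap_Omega)

text \<open>Both sides are flows, the right one by closure under products, and they agree at (0,1),
  which determines a flow.\<close>

lemma F_circ: "F (circ a b) = F a * F b"
proof -
  obtain c where c: "F a * F b = flowmap c"
    unfolding F_def using flowmap_mult by blast
  have "app (F a * F b) (0, 1) = (circ a b, 1)"
    using F_base[of b] F_point[of a b] by (simp only: times_vend.rep_eq)
  then have "app (flowmap c) (0, 1) = (circ a b, 1)"
    by (simp only: c)
  then show ?thesis
    using F_eqI c by simp
qed

text \<open>As \<open>F\<close> is injective, identities for \<open>circ\<close> can be checked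
  between operators, where associativity is free.\<close>

lemma circ_eqI: "F a * F b = F c \<Longrightarrow> circ a b = c"
  by (metis F_base F_circ prod.inject)

lemma circ_0: "circ 0 a = a" "circ a 0 = a"
  by (rule circ_eqI; simp add: F_0)+

lemma circ_inverse: "\<exists>b. circ a b = 0 \<and> circ b a = 0"
proof -
  let ?o = "Omega m n a"
  obtain b where b: "flowmap (- ?o) = F b"
    using F_eqI[OF Wmap_eq] by blast
  have "F b * F a = 1" "F a * F b = 1"
    using flowmap_uminus[of ?o] flowmap_uminus[of "- ?o"]
    by (simp_all only: F_def[of a] b[symmetric] minus_minus)
  then have "circ a b = 0" "circ b a = 0"
    by (simp_all add: circ_eqI F_0)
  then show ?thesis
    by blast
qed

lemma left_brace: "is_left_brace circ"
proof -
  have "circ (circ a b) d = circ a (circ b d)" for a b d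
    by (rule circ_eqI) (simp add: F_circ mult.assoc)
  \<comment> \<open>Here \<open>circ a b\<close> is a plus the value of \<open>F a\<close> at b, so
    the brace identity is additivity of \<open>F a\<close>.\<close>
  moreover have "circ a (b + d) + a = circ a b + circ a d" for a b d
    using app_add[of "F a" "(b, 0)" "(d, 0)"] by (simp add: flow_circ_def expL_eq F_def)
  moreover have "(\<forall>a. circ 0 a = a \<and> circ a 0 = a) \<and> (\<forall>a. \<exists>b. circ a b = 0 \<and> circ b a = 0)"
    using circ_0 circ_inverse by simp
  ultimately show ?thesis
    unfolding is_left_brace_def by blast
qed

text \<open>The star product of a and b is e^L(b) - b with L the operator of
  \<open>Omega m n a\<close>, and e^L - 1 raises the filtration.\<close>

lemma brace_star_lpow:
  assumes "i \<ge> 1" "b \<in> lpow m i"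
  shows "brace_star circ a b \<in> lpow m (Suc i)"
proof -
  have "(b, 0) \<in> V i"
    using assms by (simp add: V_def)
  from flowmap_diff_V[OF this, of "Omega m n a"] show ?thesis
    by (auto simp: V_def brace_star_def flow_circ_def expL_eq mem_Times_iff simp del: lpow.simps)
qed

text \<open>By \<open>brace_star_lpow\<close> the left powers of the brace stay inside those of the
  pre-Lie ring.\<close>

lemma left_nilpotent_brace: "left_nilpotent (brace_star circ)"
proof -
  have "lpow (brace_star circ) (Suc i) \<subseteq> lpow m (Suc i)" for i
  proof (induction i)
    case (Suc i)
    have "addgen {brace_star circ a b |a b. b \<in> lpow (brace_star circ) (Suc i)} \<subseteq> lpow m (Suc (Suc i))"
      using Suc brace_star_lpow[of "Suc i"]
      by (intro addgen_subset lpow_zero lpow_diff) (auto simp del: lpow.simps)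
    then show ?case by simp
  qed simp
  from this[of n] have "lpow (brace_star circ) (Suc n) = {0}"
    using lpow_zero[of "brace_star circ" "Suc n"] by (simp add: lpow_n del: lpow.simps) blast
  then show ?thesis
    unfolding left_nilpotent_def by blast
qed

end

theorem theorem9:
  fixes m :: "'a::{ab_group_add,finite} \<Rightarrow> 'a \<Rightarrow> 'a" and p n :: nat
  assumes "pre_lie m"
    and "left_nilpotent m"
    and "card (UNIV :: 'a set) = p ^ n"
    and "prime p"
    and "p \<ge> n + 2"
  shows "is_left_brace (flow_circ m n) \<and> left_nilpotent (brace_star (flow_circ m n))"
proof -
  interpret flow m p n
    by (rule flow.intro) (use assms in auto)
  show ?thesis
    using left_brace left_nilpotent_brace by blast
qed

end
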